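(* Let $G$ be a connected graph with $n$ vertices and $a\in V(G)$, and let $\mathbf{x}\in\mathbb{R}^c$ with $\mathbf{1}_c^T\mathbf{x}=0$. If $H$ is a graph on $c$ vertices such that $\mathbf{1}_c$ is an eigenvector of $M(H)$, then the following hold. 1. $\mathbf{x}$ is periodic (resp., sedentary) in $H$ if and only if $(\mathbf{0},\mathbf{e}_a^T\otimes\mathbf{x}^T)$ is periodic (resp., sedentary) in $G\circ H$. 2. There is PST (resp., PGST) between $\mathbf{x}$ and $\mathbf{y}$ in $H$ if and only if there is PST (resp., PGST) between $(\mathbf{0},\mathbf{e}_a^T\otimes\mathbf{x}^T)$ and $(\mathbf{0},\mathbf{e}_a^T\otimes\mathbf{y}^T)$ in $G\circ H$. In particular, pair PST (resp., pair PGST) occurs in $H$ if and only if it occurs in $G\circ H$.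
   Context: $A$ is the adjacency matrix of a graph, $\Delta$ the diagonal matrix of row sums of $A$, $L=\Delta-A$, $Q=\Delta+A$; $M$ denotes any one of $A,L,Q$ (same choice for all graphs), and $U_X(t)=\exp(itM(X))$. The vertex corona $G\circ H$ is obtained from one copy of $G$ and $n$ copies of $H$ by joining the $i$-th vertex of $G$ to every vertex of the $i$-th copy of $H$. Its vertices are ordered with those of $G$ first, followed by those of the copies of $H$ in the order of the vertices of $G$ to which they are attached; thus $(\mathbf{0},\mathbf{e}_a^T\otimes\mathbf{x}^T)\in\mathbb{R}^{n(1+c)}$ (viewed as a column vector) is $\mathbf{x}$ placed on the copy of $H$ attached to $a$, with $\mathbf{e}_a\in\mathbb{R}^n$ the characteristic vector of $a$. The vectors $\mathbf{x},\mathbf{y}\in\mathbb{R}^c$ represent real pure states, so they are nonzero (and normalized to unit vectors where relevant). PST between $\mathbf{x}$ and $\mathbf{y}$ in $X$: $U_X(\tau)\mathbf{x}=\gamma\mathbf{y}$ for some $\tau>0$, $\gamma\in\mathbb{C}$. PGST: $\lim_k U_X(t_k)\mathbf{x}=\gamma\mathbf{y}$ for some real sequence $(t_k)$ and $\gamma\in\mathbb{C}$. Periodic: PST from $\mathbf{x}$ to itself. Sedentary: for $\mathbf{x}$ a unit vector, $\inf_{t>0}|\mathbf{x}^TU_X(t)\mathbf{x}|\ge C$ for some constant $0<C\le1$. A pair state is a vector $\mathbf{e}_b-\mathbf{e}_d$ with $b\neq d$ vertices; pair PST (resp., pair PGST) occurs in a graph if there is PST (resp., PGST) between two pair states $\mathbf{p}$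 and $\mathbf{q}$ of that graph with $\mathbf{q}\neq\pm\mathbf{p}$. $\mathbf{1}_c$ is the all-ones vector of length $c$.
   Formalization: "Pair PST (PGST) occurs in H iff in G∘H" fails as stated (G=K_1, H=2K_1, M=A: P_3 has pair PST, H has none). The "if" direction is proved only when one of the two pair states of G∘H lies in the copy of H attached to a; "only if" holds as stated. *)

theory Defs
  imports "HOL-Analysis.Analysis"
begin

section \<open>Graphs and vertex coronas\<close>

text \<open>A graph is given by its adjacency relation on a finite vertex type.\<close>

definition simple_graph :: "('v::finite \<Rightarrow> 'v \<Rightarrow> bool) \<Rightarrow> bool" where
  "simple_graph E \<longleftrightarrow> symp E \<and> irreflp E"

definition connected_graph :: "('v::finite \<Rightarrow> 'v \<Rightarrow> bool) \<Rightarrow> bool" where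
  "connected_graph E \<longleftrightarrow> simple_graph E \<and> (\<forall>u v. E\<^sup>*\<^sup>* u v)"

text \<open>In the corona, \<^term>\<open>Inl u\<close> is the vertex \<^term>\<open>u\<close> of the first graph and
  \<^term>\<open>Inr (u, h)\<close> is the vertex \<^term>\<open>h\<close> in the copy of the second graph attached
  to \<^term>\<open>u\<close>.\<close>

fun corona :: "('n \<Rightarrow> 'n \<Rightarrow> bool) \<Rightarrow> ('c \<Rightarrow> 'c \<Rightarrow> bool)
    \<Rightarrow> 'n + 'n \<times> 'c \<Rightarrow> 'n + 'n \<times> 'c \<Rightarrow> bool" where
  "corona G H (Inl u) (Inl v) = G u v"
| "corona G H (Inl u) (Inr (v, k)) = (u = v)"
| "corona G H (Inr (u, h)) (Inl v) = (u = v)"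
| "corona G H (Inr (u, h)) (Inr (v, k)) = (u = v \<and> H h k)"

text \<open>The vector \<open>(0, e\<^sub>a\<^sup>T \<otimes> x\<^sup>T)\<close>.\<close>

definition corona_vec :: "'n::finite \<Rightarrow> real^'c::finite \<Rightarrow> real^('n + 'n \<times> 'c)" where
  "corona_vec a x = (\<chi> v. case v of Inl u \<Rightarrow> 0 | Inr (u, h) \<Rightarrow> axis a 1 $ u * x $ h)"


section \<open>Graph matrices and transition matrices\<close>

definition adj_matrix :: "('v::finite \<Rightarrow> 'v \<Rightarrow> bool) \<Rightarrow> real^'v^'v" where
  "adj_matrix E = (\<chi> u v. if E u v then 1 else 0)"

definition deg_matrix :: "('v::finite \<Rightarrow> 'v \<Rightarrow> bool) \<Rightarrow> real^'v^'v" where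
  "deg_matrix E = (\<chi> u v. if u = v then (\<Sum>w\<in>UNIV. adj_matrix E $ u $ w) else 0)"

text \<open>A choice of matrix has to be applied to graphs on different vertex types, so it is
  a datatype rather than a function variable.\<close>

datatype matrix_kind = Adjacency | Laplacian | Signless_Laplacian

fun graph_matrix :: "matrix_kind \<Rightarrow> ('v::finite \<Rightarrow> 'v \<Rightarrow> bool) \<Rightarrow> real^'v^'v" where
  "graph_matrix Adjacency E = adj_matrix E"
| "graph_matrix Laplacian E = deg_matrix E - adj_matrix E"
| "graph_matrix Signless_Laplacian E = deg_matrix E + adj_matrix E"

definition is_eigenvector :: "real^'v^'v \<Rightarrow> real^'v::finite \<Rightarrow> bool" where
  "is_eigenvector A x \<longleftrightarrow> x \<noteq> 0 \<and> (\<exists>\<theta>. A *v x = \<theta> *s x)"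

text \<open>The library's \<^const>\<open>exp\<close> is not available here: vectors of vectors are not an
  instance of \<^class>\<open>real_normed_algebra_1\<close>, and \<open>*\<close> on them is componentwise. Hence
  the power series over the matrix product.\<close>

definition matrix_expo :: "complex^'v^'v \<Rightarrow> complex^'v^'v::finite" where
  "matrix_expo A = (\<Sum>k. (((**) A) ^^ k) (mat 1) /\<^sub>R fact k)"

definition transition :: "matrix_kind \<Rightarrow> ('v::finite \<Rightarrow> 'v \<Rightarrow> bool) \<Rightarrow> real \<Rightarrow> complex^'v^'v" where
  "transition M E t =
     matrix_expo (map_matrix (\<lambda>r. \<i> * complex_of_real t * complex_of_real r) (graph_matrix M E))"

definition cvec :: "real^'v::finite \<Rightarrow> complex^'v" where
  "cvec x = (\<chi> v. complex_of_real (x $ v))"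


section \<open>State transfer\<close>

definition PST :: "matrix_kind \<Rightarrow> ('v::finite \<Rightarrow> 'v \<Rightarrow> bool) \<Rightarrow> real^'v \<Rightarrow> real^'v \<Rightarrow> bool" where
  "PST M E x y \<longleftrightarrow> (\<exists>\<tau>>0. \<exists>\<gamma>. transition M E \<tau> *v cvec x = \<gamma> *s cvec y)"

definition PGST :: "matrix_kind \<Rightarrow> ('v::finite \<Rightarrow> 'v \<Rightarrow> bool) \<Rightarrow> real^'v \<Rightarrow> real^'v \<Rightarrow> bool" where
  "PGST M E x y \<longleftrightarrow>
     (\<exists>(t :: nat \<Rightarrow> real) \<gamma>. (\<lambda>k. transition M E (t k) *v cvec x) \<longlonglongrightarrow> \<gamma> *s cvec y)"

definition periodic :: "matrix_kind \<Rightarrow> ('v::finite \<Rightarrow> 'v \<Rightarrow> bool) \<Rightarrow> real^'v \<Rightarrow> bool" where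
  "periodic M E x \<longleftrightarrow> PST M E x x"

text \<open>Sedentariness refers to unit vectors; a nonzero vector represents the same state as its
  normalization \<^term>\<open>sgn x\<close>, that is, \<open>x / \<parallel>x\<parallel>\<close>.\<close>

definition sedentary :: "matrix_kind \<Rightarrow> ('v::finite \<Rightarrow> 'v \<Rightarrow> bool) \<Rightarrow> real^'v \<Rightarrow> bool" where
  "sedentary M E x \<longleftrightarrow>
     (let u = cvec (sgn x)
      in \<exists>C. 0 < C \<and> C \<le> 1 \<and>
           (INF t\<in>{0<..}. cmod (scalar_product u (transition M E t *v u))) \<ge> C)"


section \<open>Pair states\<close>

definition pair_states :: "'v set \<Rightarrow> (real^'v::finite) set" where
  "pair_states S = {axis b 1 - axis d 1 | b d. b \<in> S \<and> d \<in> S \<and> b \<noteq> d}"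

text \<open>Pair state transfer in which one of the two pair states uses only vertices of \<open>S\<close>; the
  other one is an arbitrary pair state of the graph. Restricting one of them to a copy of
  \<open>H\<close> is needed for a corona \<open>G \<circ> H\<close> to have pair PST only if \<open>H\<close> has: for the adjacency
  matrix, the path on three vertices is the corona of a single vertex with the edgeless graph
  \<open>H\<close> on two vertices; it has pair PST between its two edges, but \<open>H\<close> has none.\<close>

definition pair_PST_from ::
  "'v set \<Rightarrow> matrix_kind \<Rightarrow> ('v::finite \<Rightarrow> 'v \<Rightarrow> bool) \<Rightarrow> bool" where
  "pair_PST_from S M E \<longleftrightarrow>
     (\<exists>p\<in>pair_states S. \<exists>q\<in>pair_states UNIV. q \<noteq> p \<and> q \<noteq> - p \<and> PST M E p q)"

definition pair_PGST_from ::
  "'v set \<Rightarrow> matrix_kind \<Rightarrow> ('v::finite \<Rightarrow> 'v \<Rightarrow> bool) \<Rightarrow> bool" where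
  "pair_PGST_from S M E \<longleftrightarrow>
     (\<exists>p\<in>pair_states S. \<exists>q\<in>pair_states UNIV. q \<noteq> p \<and> q \<noteq> - p \<and> PGST M E p q)"

abbreviation pair_PST :: "matrix_kind \<Rightarrow> ('v::finite \<Rightarrow> 'v \<Rightarrow> bool) \<Rightarrow> bool" where
  "pair_PST \<equiv> pair_PST_from UNIV"

abbreviation pair_PGST :: "matrix_kind \<Rightarrow> ('v::finite \<Rightarrow> 'v \<Rightarrow> bool) \<Rightarrow> bool" where
  "pair_PGST \<equiv> pair_PGST_from UNIV"

text \<open>The vertex set of the copy of the second graph attached to \<open>a\<close>.\<close>

definition corona_copy :: "'n \<Rightarrow> ('n + 'n \<times> 'c) set" where
  "corona_copy a = Inr ` ({a} \<times> UNIV)"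

end

theory Submission
  imports Defs
begin

text \<open>
  If \<open>1 \<bullet> x = 0\<close>, then the matrix of \<open>G \<circ> H\<close> sends \<open>(0, e\<^sub>a \<otimes> x)\<close> to
  \<open>(0, e\<^sub>a \<otimes> (M(H) + s) x)\<close>, where \<open>s = 0\<close> for the adjacency matrix and \<open>s = 1\<close> for the
  two Laplacians. As \<open>M(H)\<close> is symmetric with eigenvector \<open>1\<close>, it preserves the condition
  \<open>1 \<bullet> x = 0\<close>, so the walk on the corona started in \<open>(0, e\<^sub>a \<otimes> x)\<close> is the walk on
  \<open>H\<close> started in \<open>x\<close>, times the phase \<open>exp(its)\<close>. A phase changes neither moduli nor the
  target state up to a scalar; for PGST its values along the time sequence are made to
  converge by passing to a subsequence. Finally, a pair state reached from a copy of \<open>H\<close> vanishes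
  off that copy, because the walk on \<open>H\<close> preserves norms and so the scalar in the limit is nonzero.
\<close>


section \<open>The matrix exponential\<close>

lemma bounded_bilinear_matrix_mult:
  "bounded_bilinear ((**) :: complex^'n^'m \<Rightarrow> complex^'p^'n \<Rightarrow> complex^'p^'m)"
  by (simp flip: bilinear_conv_bounded_bilinear)
    (auto simp: bilinear_def intro!: linearI
      simp: vec_eq_iff matrix_matrix_mult_def sum.distrib algebra_simps scaleR_sum_right)

lemma bounded_bilinear_matrix_vector_mult:
  "bounded_bilinear ((*v) :: complex^'n^'m \<Rightarrow> complex^'n \<Rightarrow> complex^'m)"
  by (simp flip: bilinear_conv_bounded_bilinear)
    (auto simp: bilinear_def intro!: linearI
      simp: vec_eq_iff matrix_vector_mult_def sum.distrib algebra_simps scaleR_sum_right)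

interpretation matrix_mult: bounded_bilinear
  "(**) :: complex^'n^'m \<Rightarrow> complex^'p^'n \<Rightarrow> complex^'p^'m"
  by (rule bounded_bilinear_matrix_mult)

interpretation matrix_vector: bounded_bilinear
  "(*v) :: complex^'n^'m \<Rightarrow> complex^'n \<Rightarrow> complex^'m"
  by (rule bounded_bilinear_matrix_vector_mult)

lemma summable_norm_funpow_fact:
  fixes f :: "'a::real_normed_vector \<Rightarrow> 'a"
  assumes "bounded_linear f"
  shows "summable (\<lambda>k. norm ((f ^^ k) x /\<^sub>R fact k))"
proof -
  obtain C where C: "C \<ge> 0" "\<And>x. norm (f x) \<le> norm x * C"
    using bounded_linear.nonneg_bounded[OF assms] by blast
  have "norm ((f ^^ k) x) \<le> C ^ k * norm x" for k
  proof (induction k)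
    case (Suc k)
    have "norm ((f ^^ Suc k) x) \<le> norm ((f ^^ k) x) * C"
      using C(2) by simp
    also have "\<dots> \<le> C ^ k * norm x * C"
      using Suc C(1) by (intro mult_right_mono)
    finally show ?case by (simp add: mult_ac)
  qed simp
  then have "norm (norm ((f ^^ k) x /\<^sub>R fact k)) \<le> C ^ k /\<^sub>R fact k * norm x" for k
    by (simp add: divide_simps)
  then show ?thesis
    by (rule summable_comparison_test'[OF summable_mult2[OF summable_exp_generic]])
qed

definition expo_term :: "complex^'v^'v \<Rightarrow> nat \<Rightarrow> complex^'v^'v::finite" where
  "expo_term A k = (((**) A) ^^ k) (mat 1) /\<^sub>R fact k"

lemma expo_term_0 [simp]: "expo_term A 0 = mat 1"
  by (simp add: expo_term_def)

lemma mult_expo_term: "A ** expo_term A k = real (Suc k) *\<^sub>R expo_term A (Suc k)"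
  by (simp add: expo_term_def matrix_mult.scaleR_right divide_simps del: of_nat_Suc)

lemma expo_term_Suc: "expo_term A (Suc k) = (A ** expo_term A k) /\<^sub>R real (Suc k)"
  by (simp add: mult_expo_term)

lemma summable_norm_expo_term: "summable (\<lambda>k. norm (expo_term A k))"
  unfolding expo_term_def by (intro summable_norm_funpow_fact matrix_mult.bounded_linear_right)

lemma expo_term_sums: "expo_term A sums matrix_expo A"
  using summable_sums[OF summable_norm_cancel[OF summable_norm_expo_term[of A]]]
  by (simp add: matrix_expo_def expo_term_def[abs_def])

lemma matrix_expo_0 [simp]: "matrix_expo 0 = mat 1"
proof -
  have "expo_term (0 :: complex^'a^'a) k = (if k = 0 then mat 1 else 0)" for k
    by (cases k) (simp_all add: expo_term_Suc matrix_mult.zero_left)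
  then have "expo_term (0 :: complex^'a^'a) = (\<lambda>k. if k = 0 then mat 1 else 0)"
    by (rule ext)
  then show ?thesis
    using expo_term_sums[of "0 :: complex^'a^'a"] sums_single[of 0 "\<lambda>_. mat 1 :: complex^'a^'a"]
    by (auto intro: sums_unique2)
qed

lemma expo_term_commute:
  assumes "A ** B = B ** A"
  shows "expo_term A k ** B = B ** expo_term A k"
proof (induction k)
  case (Suc k)
  show ?case
    by (metis Suc assms expo_term_Suc matrix_mul_assoc matrix_mult.scaleR_left
        matrix_mult.scaleR_right)
qed simp

lemma expo_term_add_commuting:
  assumes "A ** B = B ** A"
  shows "expo_term (A + B) n = (\<Sum>i\<le>n. expo_term A i ** expo_term B (n - i))"
proof (induction n)
  case (Suc n)
  let ?S = "expo_term"
  have "real (Suc n) *\<^sub>R ?S (A + B) (Suc n) = (A + B) ** (\<Sum>i\<le>n. ?S A i ** ?S B (n - i))"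
    by (metis Suc mult_expo_term)
  also have "\<dots> = (\<Sum>i\<le>n. (A ** ?S A i) ** ?S B (n - i)) + (\<Sum>i\<le>n. ?S A i ** (B ** ?S B (n - i)))"
    by (simp add: matrix_mult.add_left matrix_mult.sum_right matrix_mul_assoc
        expo_term_commute[OF assms] sum.distrib)
  also have "\<dots> = (\<Sum>i\<le>n. real (Suc i) *\<^sub>R (?S A (Suc i) ** ?S B (n - i)))
                + (\<Sum>i\<le>n. real (Suc n - i) *\<^sub>R (?S A i ** ?S B (Suc n - i)))"
    by (simp add: mult_expo_term Suc_diff_le matrix_mult.scaleR_left matrix_mult.scaleR_right
        del: of_nat_Suc)
  also have "(\<Sum>i\<le>n. real (Suc i) *\<^sub>R (?S A (Suc i) ** ?S B (n - i)))
           = (\<Sum>i\<le>Suc n. real i *\<^sub>R (?S A i ** ?S B (Suc n - i)))"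
    by (subst sum.atMost_Suc_shift) simp
  also have "(\<Sum>i\<le>n. real (Suc n - i) *\<^sub>R (?S A i ** ?S B (Suc n - i)))
           = (\<Sum>i\<le>Suc n. real (Suc n - i) *\<^sub>R (?S A i ** ?S B (Suc n - i)))"
    by simp
  also have "(\<Sum>i\<le>Suc n. real i *\<^sub>R (?S A i ** ?S B (Suc n - i)))
           + (\<Sum>i\<le>Suc n. real (Suc n - i) *\<^sub>R (?S A i ** ?S B (Suc n - i)))
           = real (Suc n) *\<^sub>R (\<Sum>i\<le>Suc n. ?S A i ** ?S B (Suc n - i))"
    by (simp add: scaleR_sum_right flip: sum.distrib scaleR_add_left of_nat_add
        del: sum.atMost_Suc of_nat_Suc)
  finally show ?case
    by (simp del: sum.atMost_Suc of_nat_Suc)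
qed simp

lemma matrix_expo_add_commuting:
  assumes "A ** B = B ** A"
  shows "matrix_expo (A + B) = matrix_expo A ** matrix_expo B"
proof -
  have entry: "summable (\<lambda>k. norm (expo_term C k $ i $ j))"
      "(\<Sum>k. expo_term C k $ i $ j) = matrix_expo C $ i $ j" for C :: "complex^'a^'a" and i j
  proof -
    have "norm (norm (expo_term C k $ i $ j)) \<le> norm (expo_term C k)" for k
      using Finite_Cartesian_Product.norm_nth_le[of "expo_term C k $ i" j]
        Finite_Cartesian_Product.norm_nth_le[of "expo_term C k" i] by simp
    then show "summable (\<lambda>k. norm (expo_term C k $ i $ j))"
      by (rule summable_comparison_test'[OF summable_norm_expo_term[of C]])
    have "bounded_linear (\<lambda>X :: complex^'a^'a. X $ i $ j)"
      by (intro bounded_linear_compose[OF bounded_linear_vec_nth] bounded_linear_vec_nth)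
    then show "(\<Sum>k. expo_term C k $ i $ j) = matrix_expo C $ i $ j"
      using bounded_linear.sums[of "\<lambda>X. X $ i $ j", OF _ expo_term_sums[of C]]
      by (auto simp: sums_iff)
  qed
  have "(\<lambda>n. (\<Sum>k\<le>n. expo_term A k ** expo_term B (n - k)) $ i $ j)
      sums ((matrix_expo A ** matrix_expo B) $ i $ j)" for i j
  proof -
    have "(\<lambda>n. \<Sum>l\<in>UNIV. \<Sum>k\<le>n. expo_term A k $ i $ l * expo_term B (n - k) $ l $ j)
        sums (\<Sum>l\<in>UNIV. matrix_expo A $ i $ l * matrix_expo B $ l $ j)"
      by (intro sums_sum) (use Cauchy_product_sums[OF entry(1) entry(1)] in \<open>simp add: entry(2)\<close>)
    then show ?thesis
      by (simp add: matrix_matrix_mult_def sum.swap[of _ UNIV])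
  qed
  then have "(\<lambda>n. \<Sum>k\<le>n. expo_term A k ** expo_term B (n - k))
      sums (matrix_expo A ** matrix_expo B)"
    unfolding sums_def by (intro vec_tendstoI) simp
  then have "expo_term (A + B) sums (matrix_expo A ** matrix_expo B)"
    by (simp add: expo_term_add_commuting[OF assms, abs_def])
  with expo_term_sums show ?thesis
    by (rule sums_unique2)
qed

lemma matrix_expo_map:
  assumes "bounded_linear \<phi>" and "\<phi> (mat 1) = mat 1"
    and "\<And>X. A ** X = X ** A \<Longrightarrow> \<phi> (A ** X) = B ** \<phi> X"
  shows "\<phi> (matrix_expo A) = matrix_expo B"
proof -
  have "\<phi> (expo_term A k) = expo_term B k" for k
  proof (induction k)
    case (Suc k)
    then show ?case
      by (simp add: expo_term_Suc linear_cmul[OF bounded_linear.linear[OF assms(1)]] assms(3)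
          expo_term_commute)
  qed (simp add: assms(2))
  then have "expo_term B sums \<phi> (matrix_expo A)"
    using bounded_linear.sums[OF assms(1) expo_term_sums[of A]] by simp
  then show ?thesis
    using expo_term_sums by (rule sums_unique2)
qed

lemma matrix_expo_intertwine:
  assumes "bounded_linear \<phi>" and "z \<in> S"
    and "\<And>w. w \<in> S \<Longrightarrow> B *v w \<in> S" and "\<And>w. w \<in> S \<Longrightarrow> A *v \<phi> w = \<phi> (B *v w)"
  shows "matrix_expo A *v \<phi> z = \<phi> (matrix_expo B *v z)"
proof -
  let ?pow = "\<lambda>C k. (((**) C) ^^ k) (mat 1)"
  have "?pow B k *v z \<in> S \<and> ?pow A k *v \<phi> z = \<phi> (?pow B k *v z)" for k
    by (induction k) (auto simp: assms simp flip: matrix_vector_mul_assoc)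
  then have "expo_term A k *v \<phi> z = \<phi> (expo_term B k *v z)" for k
    by (simp add: expo_term_def matrix_vector.scaleR_left
        linear_cmul[OF bounded_linear.linear[OF assms(1)]])
  then show ?thesis
    using bounded_linear.sums[OF matrix_vector.bounded_linear_left expo_term_sums[of A], of "\<phi> z"]
      bounded_linear.sums[OF assms(1)
        bounded_linear.sums[OF matrix_vector.bounded_linear_left expo_term_sums[of B], of z]]
    by (auto intro: sums_unique2)
qed

lemma mat_mult_vector: "mat c *v z = c *s (z :: 'a::semiring_1^'v::finite)"
  by (simp add: vec_eq_iff matrix_vector_mult_def mat_def if_distrib[of "\<lambda>d. d * _"] cong: if_cong)

lemma matrix_expo_mat: "matrix_expo (mat c) = mat (exp c)"
proof -
  have mat_mult: "mat c ** mat d = (mat (c * d) :: complex^'a^'a)" for d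
    by (simp add: vec_eq_iff matrix_matrix_mult_def mat_def if_distrib[of "\<lambda>d. d * _"] cong: if_cong)
  have scale: "r *\<^sub>R mat d = (mat (r *\<^sub>R d) :: complex^'a^'a)" for r d
    by (simp add: vec_eq_iff mat_def)
  have "expo_term (mat c :: complex^'a^'a) k = mat (c ^ k /\<^sub>R fact k)" for k
    by (induction k) (simp_all add: expo_term_Suc mat_mult scale mult_ac)
  then have terms: "expo_term (mat c :: complex^'a^'a) = (\<lambda>k. mat (c ^ k /\<^sub>R fact k))"
    by (rule ext)
  have "bounded_linear (mat :: complex \<Rightarrow> complex^'a^'a)"
    by (simp flip: linear_conv_bounded_linear) (auto intro!: linearI simp: vec_eq_iff mat_def)
  from bounded_linear.sums[OF this exp_converges[of c]]
  have "expo_term (mat c :: complex^'a^'a) sums mat (exp c)"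
    unfolding terms .
  with expo_term_sums show ?thesis
    by (rule sums_unique2)
qed

lemma matrix_expo_add_mat_mult:
  "matrix_expo (A + mat c) *v z = exp c *s (matrix_expo A *v z)"
proof -
  have "A ** mat c = mat c ** A"
    by (simp add: vec_eq_iff matrix_matrix_mult_def mat_def if_distrib[of "\<lambda>d. d * _"]
        if_distrib[of "\<lambda>d. _ * d"] mult_ac cong: if_cong)
  then have "matrix_expo (mat c + A) = matrix_expo (mat c) ** matrix_expo A"
    by (intro matrix_expo_add_commuting) simp
  then show ?thesis
    by (simp add: matrix_expo_mat mat_mult_vector add.commute flip: matrix_vector_mul_assoc)
qed


section \<open>Continuous quantum walks\<close>

abbreviation cmat :: "complex \<Rightarrow> real^'v^'w \<Rightarrow> complex^'v^'w" where
  "cmat c \<equiv> map_matrix (\<lambda>r. c * complex_of_real r)"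

lemma cmat_mult_cvec: "cmat c A *v (d *s cvec x) = (c * d) *s cvec (A *v x)"
  by (simp add: vec_eq_iff matrix_vector_mult_def cvec_def sum_distrib_left mult_ac)

lemma cmat_add_mat: "cmat c (A + mat s) = cmat c A + mat (c * complex_of_real s)"
  by (simp add: vec_eq_iff mat_def algebra_simps)

lemma norm_matrix_expo_imaginary:
  assumes "transpose A = A"
  shows "norm (matrix_expo (cmat (\<i> * complex_of_real t) A) *v cvec x) = norm x"
proof -
  let ?X = "cmat (\<i> * complex_of_real t) A"
  let ?V = "matrix_expo (- ?X)"
  define w where "w = matrix_expo ?X *v cvec x"
  have sym: "A $ i $ j = A $ j $ i" for i j
    using arg_cong[OF assms, of "\<lambda>Y. Y $ j $ i"] by (simp add: transpose_def)
  have "transpose ?V = ?V"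
  proof (rule matrix_expo_map)
    show "bounded_linear (transpose :: complex^'a^'a \<Rightarrow> _)"
      by (simp flip: linear_conv_bounded_linear)
        (auto intro!: linearI simp: vec_eq_iff transpose_def)
    have "transpose (- ?X) = - ?X"
      by (simp add: vec_eq_iff transpose_def sym)
    then show "transpose (- ?X ** Y) = - ?X ** transpose Y" if "- ?X ** Y = Y ** - ?X" for Y
      by (metis that matrix_transpose_mul)
  qed simp
  from arg_cong[OF this, of "\<lambda>Y. Y $ i $ j" for i j]
  have V_sym: "?V $ j $ i = ?V $ i $ j" for i j
    by (simp add: transpose_def)
  have V_cnj: "map_matrix cnj (matrix_expo ?X) = ?V"
  proof (rule matrix_expo_map)
    show "bounded_linear (map_matrix cnj :: complex^'a^'a \<Rightarrow> _)"
      by (simp flip: linear_conv_bounded_linear) (auto intro!: linearI simp: vec_eq_iff)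
    show "map_matrix cnj (?X ** Y) = - ?X ** map_matrix cnj Y" for Y
      by (simp add: vec_eq_iff matrix_matrix_mult_def)
  qed (simp add: vec_eq_iff mat_def)
  have "?V ** matrix_expo ?X = matrix_expo (- ?X + ?X)"
    by (rule matrix_expo_add_commuting[symmetric])
      (simp add: matrix_mult.minus_left matrix_mult.minus_right)
  then have Vw: "?V *v w = cvec x"
    by (simp add: w_def matrix_vector_mul_assoc)
  have "cnj (w $ i) = (\<Sum>j\<in>UNIV. ?V $ i $ j * cvec x $ j)" for i
    by (simp add: w_def matrix_vector_mult_def cvec_def flip: V_cnj)
  then have cnj_w: "cnj (w $ i) = (\<Sum>j\<in>UNIV. cvec x $ j * ?V $ j $ i)" for i
    by (subst V_sym) (simp add: mult.commute)
  have "complex_of_real ((norm w)\<^sup>2) = (\<Sum>i\<in>UNIV. cnj (w $ i) * w $ i)"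
    by (simp add: norm_vec_def L2_set_def sum_nonneg complex_norm_square mult.commute
        del: of_real_power)
  also have "\<dots> = (\<Sum>i\<in>UNIV. \<Sum>j\<in>UNIV. cvec x $ j * (?V $ j $ i * w $ i))"
    by (simp add: cnj_w sum_distrib_right mult.assoc)
  also have "\<dots> = (\<Sum>j\<in>UNIV. cvec x $ j * (?V *v w) $ j)"
    by (subst sum.swap) (simp add: matrix_vector_mult_def sum_distrib_left)
  also have "\<dots> = complex_of_real ((norm x)\<^sup>2)"
    by (simp add: Vw cvec_def norm_vec_def L2_set_def sum_nonneg power2_eq_square del: of_real_power)
  finally have "(norm w)\<^sup>2 = (norm x)\<^sup>2"
    by (simp only: of_real_eq_iff)
  then show ?thesis
    by (simp add: w_def)
qed

lemma transpose_graph_matrix: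
  assumes "simple_graph E"
  shows "transpose (graph_matrix M E) = graph_matrix M E"
proof -
  have "E u v \<longleftrightarrow> E v u" for u v
    using assms by (auto simp: simple_graph_def symp_def)
  then show ?thesis
    by (cases M) (auto simp: vec_eq_iff transpose_def adj_matrix_def deg_matrix_def)
qed

lemma norm_transition:
  assumes "simple_graph E"
  shows "norm (transition M E t *v cvec x) = norm x"
  unfolding transition_def
  by (rule norm_matrix_expo_imaginary[OF transpose_graph_matrix[OF assms]])

lemma PST_imp_PGST:
  assumes "PST M E x y"
  shows "PGST M E x y"
proof -
  obtain \<tau> \<gamma> where "transition M E \<tau> *v cvec x = \<gamma> *s cvec y"
    using assms by (auto simp: PST_def)
  then show ?thesis
    unfolding PGST_def by (intro exI[of _ "\<lambda>_. \<tau>"] exI[of _ \<gamma>]) simp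
qed

lemma tendsto_vector_smult:
  fixes f :: "'a \<Rightarrow> complex^'v::finite"
  assumes "(p \<longlongrightarrow> c) F" and "(f \<longlongrightarrow> z) F"
  shows "((\<lambda>k. p k *s f k) \<longlongrightarrow> c *s z) F"
  using assms by (intro vec_tendstoI) (auto intro!: tendsto_intros)

lemma unimodular_smult_subsequence:
  fixes f :: "nat \<Rightarrow> complex^'v::finite"
  assumes "f \<longlonglongrightarrow> \<gamma> *s z" and "\<And>k. cmod (p k) = 1"
  obtains r \<delta> where "strict_mono r" and "(\<lambda>k. p (r k) *s f (r k)) \<longlonglongrightarrow> \<delta> *s z"
proof -
  have "bounded (range p)"
    unfolding bounded_iff using assms(2) by (metis imageE order_refl)
  then obtain c r where r: "strict_mono r" "(p \<circ> r) \<longlonglongrightarrow> c"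
    using bounded_imp_convergent_subsequence by blast
  have "(\<lambda>k. p (r k) *s f (r k)) \<longlonglongrightarrow> c *s (\<gamma> *s z)"
    using tendsto_vector_smult[OF r(2) LIMSEQ_subseq_LIMSEQ[OF assms(1) r(1)]] by (simp add: o_def)
  then show ?thesis
    by (intro that[OF r(1)]) (simp add: vector_smult_assoc)
qed


section \<open>Walks on a vertex corona\<close>

definition ccorona_vec :: "'n::finite \<Rightarrow> complex^'c::finite \<Rightarrow> complex^('n + 'n \<times> 'c)" where
  "ccorona_vec a z = (\<chi> v. case v of Inl u \<Rightarrow> 0 | Inr (u, h) \<Rightarrow> axis a 1 $ u * z $ h)"

lemma corona_vec_nth [simp]:
  "corona_vec a x $ Inl u = 0" "corona_vec a x $ Inr (u, h) = (if u = a then x $ h else 0)"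
  by (auto simp: corona_vec_def axis_def)

lemma ccorona_vec_nth [simp]:
  "ccorona_vec a z $ Inl u = 0" "ccorona_vec a z $ Inr (u, h) = (if u = a then z $ h else 0)"
  by (auto simp: ccorona_vec_def axis_def)

lemma vec_eq_iff_corona:
  "x = y \<longleftrightarrow> (\<forall>u. x $ Inl u = y $ Inl u) \<and> (\<forall>u h. x $ Inr (u, h) = y $ Inr (u, h))"
  by (simp add: vec_eq_iff split_sum_all)

lemma cvec_corona_vec: "cvec (corona_vec a x) = ccorona_vec a (cvec x)"
  by (simp add: vec_eq_iff_corona cvec_def)

lemma ccorona_vec_smult: "ccorona_vec a (c *s z) = c *s ccorona_vec a z"
  by (simp add: vec_eq_iff_corona)

lemma bounded_linear_ccorona_vec: "bounded_linear (ccorona_vec a)"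
  by (simp flip: linear_conv_bounded_linear) (auto intro!: linearI simp: vec_eq_iff_corona)

lemma ccorona_vec_eq_iff [simp]: "ccorona_vec a z = ccorona_vec a w \<longleftrightarrow> z = w"
  by (auto simp: vec_eq_iff_corona) (auto simp: vec_eq_iff)

lemma corona_vec_eq_iff [simp]: "corona_vec a x = corona_vec a y \<longleftrightarrow> x = y"
  by (auto simp: vec_eq_iff_corona) (auto simp: vec_eq_iff)

lemma sum_corona:
  "(\<Sum>v\<in>UNIV. f v) = (\<Sum>u\<in>UNIV. f (Inl u)) + (\<Sum>u\<in>UNIV. \<Sum>h\<in>UNIV. f (Inr (u, h)))"
  for f :: "'n::finite + 'n \<times> 'c::finite \<Rightarrow> 'a::comm_monoid_add"
  by (simp add: sum.cartesian_product sum.Plus flip: UNIV_Plus_UNIV UNIV_Times_UNIV)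

lemma sum_if_eq_sum:
  "(\<Sum>u\<in>UNIV. \<Sum>h\<in>UNIV. if u = a then f h else 0) = (\<Sum>h\<in>UNIV. f h)"
  for a :: "'n::finite" and f :: "'c::finite \<Rightarrow> 'a::comm_monoid_add"
  by (subst sum.swap) simp

lemma norm_ccorona_vec: "norm (ccorona_vec a z) = norm z"
  by (simp add: norm_vec_def L2_set_def sum_corona if_distrib[of norm]
      if_distrib[of "\<lambda>r. r ^ 2"] sum_if_eq_sum cong: if_cong)

lemma norm_corona_vec: "norm (corona_vec a x) = norm x"
  by (simp add: norm_vec_def L2_set_def sum_corona if_distrib[of abs]
      if_distrib[of "\<lambda>r. r ^ 2"] sum_if_eq_sum cong: if_cong)

lemma sgn_corona_vec: "sgn (corona_vec a x) = corona_vec a (sgn x)"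
  by (simp add: vec_eq_iff_corona sgn_div_norm norm_corona_vec)

lemma scalar_product_ccorona_vec:
  "scalar_product (ccorona_vec a z) (c *s ccorona_vec a w) = c * scalar_product z w"
proof -
  have "(if u = a then z $ h else 0) * (c * (if u = a then w $ h else 0)) =
      (if u = a then c * (z $ h * w $ h) else 0)" for u h
    by simp
  then show ?thesis
    by (simp add: scalar_product_def sum_corona sum_if_eq_sum sum_distrib_left)
qed

definition corona_shift :: "matrix_kind \<Rightarrow> real" where
  "corona_shift M = (case M of Adjacency \<Rightarrow> 0 | _ \<Rightarrow> 1)"

lemma adj_matrix_corona:
  assumes "1 \<bullet> x = 0"
  shows "adj_matrix (corona G H) *v corona_vec a x = corona_vec a (adj_matrix H *v x)"
proof -
  have sum0: "(\<Sum>h\<in>UNIV. x $ h) = 0"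
    using assms by (simp add: inner_vec_def)
  have [simp]: "(\<Sum>h\<in>UNIV. if u = a then x $ h else 0) = 0" for u
    by (cases "u = a") (simp_all add: sum0)
  have "(if u = v then 1 else 0) * (if v = a then x $ h else 0) =
      (if v = a then (if u = a then x $ h else 0) else 0)" for u v h
    by simp
  moreover have "(if u = v \<and> H k h then 1 else 0) * (if v = a then x $ h else 0) =
      (if v = a then (if u = a then (if H k h then 1 else 0) * x $ h else 0) else 0)" for u v k h
    by simp
  ultimately show ?thesis
    by (auto simp: vec_eq_iff_corona matrix_vector_mult_def adj_matrix_def sum_corona sum_if_eq_sum)
qed

lemma deg_matrix_mult: "(deg_matrix E *v x) $ v = (\<Sum>w\<in>UNIV. adj_matrix E $ v $ w) * x $ v"
  by (simp add: deg_matrix_def matrix_vector_mult_def if_distrib[of "\<lambda>d. d * _"] cong: if_cong)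

lemma degree_corona_copy:
  "(\<Sum>w\<in>UNIV. adj_matrix (corona G H) $ Inr (u, h) $ w) = 1 + (\<Sum>k\<in>UNIV. adj_matrix H $ h $ k)"
proof -
  have "(if u = v \<and> H h k then 1 else 0) = (if v = u then if H h k then 1 else 0 else (0::real))"
    for v k
    by simp
  then show ?thesis
    by (simp add: adj_matrix_def sum_corona sum_if_eq_sum)
qed

lemma deg_matrix_corona:
  "deg_matrix (corona G H) *v corona_vec a x = corona_vec a (deg_matrix H *v x + x)"
  by (simp add: vec_eq_iff_corona deg_matrix_mult degree_corona_copy algebra_simps)

lemma corona_vec_add: "corona_vec a (x + y) = corona_vec a x + corona_vec a y"
  by (simp add: vec_eq_iff_corona)

lemma corona_vec_diff: "corona_vec a (x - y) = corona_vec a x - corona_vec a y"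
  by (simp add: vec_eq_iff_corona)

text \<open>The vertices of \<open>G\<close> receive the entries of \<open>x\<close> only through their vanishing sum, and the edge
  to \<open>a\<close> raises every degree in the copy by one.\<close>

lemma graph_matrix_corona:
  assumes "1 \<bullet> x = 0"
  shows "graph_matrix M (corona G H) *v corona_vec a x =
    corona_vec a ((graph_matrix M H + mat (corona_shift M)) *v x)"
  by (cases M)
    (simp_all add: corona_shift_def matrix_vector_mult_add_rdistrib matrix_vector_mult_diff_rdistrib
      adj_matrix_corona[OF assms] deg_matrix_corona corona_vec_add corona_vec_diff)

lemma graph_matrix_preserves_sum_zero:
  assumes "simple_graph H" and "is_eigenvector (graph_matrix M H) 1" and "1 \<bullet> x = 0"
  shows "1 \<bullet> ((graph_matrix M H + mat s) *v x) = 0"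
proof -
  obtain \<theta> where "graph_matrix M H *v 1 = \<theta> *s 1"
    using assms(2) by (auto simp: is_eigenvector_def)
  then have "1 \<bullet> (graph_matrix M H *v x) = (\<theta> *s 1) \<bullet> x"
    by (metis dot_lmul_matrix transpose_graph_matrix[OF assms(1)] vector_transpose_matrix)
  also have "\<dots> = 0"
    using assms(3) by (simp add: inner_vec_def flip: sum_distrib_left)
  finally show ?thesis
    using assms(3)
    by (simp add: matrix_vector_mult_add_rdistrib mat_mult_vector inner_add_right)
      (simp add: inner_vec_def flip: sum_distrib_left)
qed

lemma transition_corona:
  fixes H :: "'c::finite \<Rightarrow> 'c \<Rightarrow> bool"
  assumes "simple_graph H" and "is_eigenvector (graph_matrix M H) 1" and "1 \<bullet> x = 0"
  shows "transition M (corona G H) t *v ccorona_vec a (cvec x) =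
    exp (\<i> * complex_of_real t * complex_of_real (corona_shift M)) *s
      ccorona_vec a (transition M H t *v cvec x)"
proof -
  let ?K = "graph_matrix M H + mat (corona_shift M)"
  define S where "S = {d *s cvec y | d (y :: real^'c). 1 \<bullet> y = 0}"
  have "cvec x \<in> S"
    unfolding S_def using assms(3) by (intro CollectI exI[of _ 1] exI[of _ x]) simp
  moreover have "cmat c ?K *v w \<in> S" if "w \<in> S" for c w
    using that graph_matrix_preserves_sum_zero[OF assms(1,2)]
    unfolding S_def by (auto simp: cmat_mult_cvec simp del: vector_smult_assoc) blast
  moreover have "cmat c (graph_matrix M (corona G H)) *v ccorona_vec a w =
      ccorona_vec a (cmat c ?K *v w)" if w: "w \<in> S" for c w
  proof -
    obtain d y where y: "w = d *s cvec y" "1 \<bullet> y = 0"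
      using w by (auto simp: S_def)
    then have "ccorona_vec a w = d *s cvec (corona_vec a y)"
      by (simp add: ccorona_vec_smult cvec_corona_vec)
    then have "cmat c (graph_matrix M (corona G H)) *v ccorona_vec a w =
        (c * d) *s cvec (corona_vec a (?K *v y))"
      by (simp only: cmat_mult_cvec graph_matrix_corona[OF y(2)])
    then show ?thesis
      by (simp only: y(1) cmat_mult_cvec ccorona_vec_smult cvec_corona_vec)
  qed
  ultimately have "matrix_expo (cmat c (graph_matrix M (corona G H))) *v ccorona_vec a (cvec x) =
      ccorona_vec a (matrix_expo (cmat c ?K) *v cvec x)" for c
    by (intro matrix_expo_intertwine[OF bounded_linear_ccorona_vec])
  then show ?thesis
    by (simp add: transition_def cmat_add_mat matrix_expo_add_mat_mult
        ccorona_vec_smult)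
qed

lemma norm_exp_i_of_real_mult: "cmod (exp (\<i> * complex_of_real t * complex_of_real s)) = 1"
  by (simp add: norm_exp_eq_Re)

lemma PST_corona_iff:
  assumes "simple_graph H" and "is_eigenvector (graph_matrix M H) 1" and "1 \<bullet> x = 0"
  shows "PST M (corona G H) (corona_vec a x) (corona_vec a y) \<longleftrightarrow> PST M H x y"
proof -
  let ?p = "\<lambda>t. exp (\<i> * complex_of_real t * complex_of_real (corona_shift M))"
  have iff: "transition M (corona G H) t *v cvec (corona_vec a x) = \<gamma> *s cvec (corona_vec a y) \<longleftrightarrow>
      transition M H t *v cvec x = (\<gamma> / ?p t) *s cvec y" for t \<gamma>
    unfolding cvec_corona_vec transition_corona[OF assms]
    by (simp flip: ccorona_vec_smult) (auto simp: vec_eq_iff field_simps)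
  have "(\<exists>\<gamma>. P (\<gamma> / ?p t)) \<longleftrightarrow> (\<exists>\<gamma>. P \<gamma>)" for P t
    by (metis exp_not_eq_zero nonzero_mult_div_cancel_right)
  from this[of "\<lambda>\<delta>. transition M H t *v cvec x = \<delta> *s cvec y" t for t]
  show ?thesis
    unfolding PST_def by (simp add: iff)
qed

lemma PGST_corona_iff:
  fixes H :: "'c::finite \<Rightarrow> 'c \<Rightarrow> bool"
  assumes "simple_graph H" and "is_eigenvector (graph_matrix M H) 1" and "1 \<bullet> x = 0"
  shows "PGST M (corona G H) (corona_vec a x) (corona_vec a y) \<longleftrightarrow> PGST M H x y"
proof
  let ?p = "\<lambda>t. exp (\<i> * complex_of_real t * complex_of_real (corona_shift M))"
  assume "PGST M H x y"
  then obtain t \<gamma> where lim: "(\<lambda>k. transition M H (t k) *v cvec x) \<longlonglongrightarrow> \<gamma> *s cvec y"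
    by (auto simp: PGST_def)
  obtain r \<delta> where
    "(\<lambda>k. ?p (t (r k)) *s (transition M H (t (r k)) *v cvec x)) \<longlonglongrightarrow> \<delta> *s cvec y"
    by (rule unimodular_smult_subsequence[OF lim, of "\<lambda>k. ?p (t k)"]) (rule norm_exp_i_of_real_mult)
  from bounded_linear.tendsto[OF bounded_linear_ccorona_vec[of a] this]
  have "(\<lambda>k. transition M (corona G H) (t (r k)) *v cvec (corona_vec a x))
      \<longlonglongrightarrow> \<delta> *s cvec (corona_vec a y)"
    by (simp add: transition_corona[OF assms] ccorona_vec_smult cvec_corona_vec)
  then show "PGST M (corona G H) (corona_vec a x) (corona_vec a y)"
    unfolding PGST_def by (intro exI[of _ "\<lambda>k. t (r k)"] exI[of _ \<delta>])
next
  let ?p = "\<lambda>t. exp (\<i> * complex_of_real t * complex_of_real (corona_shift M))"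
  assume "PGST M (corona G H) (corona_vec a x) (corona_vec a y)"
  then obtain t \<gamma> where lim:
    "(\<lambda>k. transition M (corona G H) (t k) *v cvec (corona_vec a x)) \<longlonglongrightarrow> \<gamma> *s cvec (corona_vec a y)"
    by (auto simp: PGST_def)
  obtain r \<delta> where
    "(\<lambda>k. inverse (?p (t (r k))) *s
        (transition M (corona G H) (t (r k)) *v cvec (corona_vec a x)))
      \<longlonglongrightarrow> \<delta> *s cvec (corona_vec a y)"
    by (rule unimodular_smult_subsequence[OF lim, of "\<lambda>k. inverse (?p (t k))"])
      (simp add: norm_inverse norm_exp_i_of_real_mult)
  then have "(\<lambda>k. ccorona_vec a (transition M H (t (r k)) *v cvec x))
      \<longlonglongrightarrow> ccorona_vec a (\<delta> *s cvec y)"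
    by (simp add: transition_corona[OF assms] vector_smult_assoc ccorona_vec_smult cvec_corona_vec)
  from tendsto_vec_nth[OF this, of "Inr (a, h)" for h]
  have "(\<lambda>k. transition M H (t (r k)) *v cvec x) \<longlonglongrightarrow> \<delta> *s cvec y"
    by (intro vec_tendstoI) simp
  then show "PGST M H x y"
    unfolding PGST_def by (intro exI[of _ "\<lambda>k. t (r k)"] exI[of _ \<delta>])
qed

lemma sedentary_corona_iff:
  assumes "simple_graph H" and "is_eigenvector (graph_matrix M H) 1" and "1 \<bullet> x = 0"
  shows "sedentary M (corona G H) (corona_vec a x) \<longleftrightarrow> sedentary M H x"
proof -
  have "1 \<bullet> sgn x = 0"
    using assms(3) by (simp add: sgn_div_norm)
  then show ?thesis
    by (simp add: sedentary_def sgn_corona_vec transition_corona[OF assms(1,2)] Let_def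
        cvec_corona_vec scalar_product_ccorona_vec norm_mult norm_exp_i_of_real_mult)
qed

lemma PGST_corona_support:
  fixes H :: "'c::finite \<Rightarrow> 'c \<Rightarrow> bool"
  assumes "simple_graph H" and "is_eigenvector (graph_matrix M H) 1" and "1 \<bullet> x = 0" and "x \<noteq> 0"
    and "PGST M (corona G H) (corona_vec a x) q" and "v \<notin> corona_copy a"
  shows "q $ v = 0"
proof -
  obtain t \<gamma> where lim:
    "(\<lambda>k. transition M (corona G H) (t k) *v cvec (corona_vec a x)) \<longlonglongrightarrow> \<gamma> *s cvec q"
    using assms(5) by (auto simp: PGST_def)
  have smult_norm: "norm (c *s z) = norm z" if "cmod c = 1" for c and z :: "complex^'d::finite"
    using that by (simp add: norm_vec_def norm_mult)
  have "norm (transition M (corona G H) (t k) *v cvec (corona_vec a x)) = norm x" for k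
    by (simp add: cvec_corona_vec transition_corona[OF assms(1-3)] smult_norm norm_exp_i_of_real_mult norm_ccorona_vec
        norm_transition[OF assms(1)])
  with tendsto_norm[OF lim] have "norm (\<gamma> *s cvec q) = norm x"
    by (simp add: LIMSEQ_const_iff)
  with \<open>x \<noteq> 0\<close> have "\<gamma> \<noteq> 0"
    by auto
  have "ccorona_vec a z $ v = 0" for z :: "complex^'c"
    using assms(6) by (cases v) (auto simp: corona_copy_def)
  then have "(\<gamma> *s cvec q) $ v = 0"
    using tendsto_vec_nth[OF lim, of v]
    by (simp add: cvec_corona_vec transition_corona[OF assms(1-3)] LIMSEQ_const_iff)
  with \<open>\<gamma> \<noteq> 0\<close> show ?thesis
    by (simp add: cvec_def)
qed


section \<open>Pair states of a vertex corona\<close>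

lemma corona_vec_axis: "corona_vec a (axis b 1) = axis (Inr (a, b)) 1"
  by (auto simp: vec_eq_iff_corona axis_def)

lemma pair_states_corona_copy:
  "pair_states (corona_copy a) = corona_vec a ` pair_states (UNIV :: 'c::finite set)"
proof -
  have "pair_states (corona_copy a) =
      {axis (Inr (a, b)) 1 - axis (Inr (a, d)) 1 | b (d :: 'c). b \<noteq> d}"
    by (auto simp: pair_states_def corona_copy_def)
  also have "\<dots> = {corona_vec a (axis b 1 - axis d 1) | b (d :: 'c). b \<noteq> d}"
    by (simp add: corona_vec_diff corona_vec_axis)
  also have "\<dots> = corona_vec a ` pair_states UNIV"
    by (auto simp: pair_states_def)
  finally show ?thesis .
qed

lemma pair_states_mono: "S \<subseteq> T \<Longrightarrow> pair_states S \<subseteq> pair_states T"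
  by (auto simp: pair_states_def)

lemma pair_states_supported:
  assumes "q \<in> pair_states UNIV" and "\<And>v. v \<notin> S \<Longrightarrow> q $ v = 0"
  shows "q \<in> pair_states S"
proof -
  obtain b d where q: "q = axis b 1 - axis d 1" "b \<noteq> d"
    using assms(1) by (auto simp: pair_states_def)
  then have "q $ b \<noteq> 0" "q $ d \<noteq> 0"
    by (auto simp: axis_def)
  then have "b \<in> S" "d \<in> S"
    using assms(2) by blast+
  with q show ?thesis
    by (auto simp: pair_states_def)
qed

lemma pair_state_sum_zero_nonzero:
  assumes "p \<in> pair_states S"
  shows "1 \<bullet> p = 0" and "p \<noteq> 0"
proof -
  obtain b d where p: "p = axis b 1 - axis d 1" "b \<noteq> d"
    using assms by (auto simp: pair_states_def)
  then show "1 \<bullet> p = 0"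
    by (simp add: inner_diff_right inner_axis)
  show "p \<noteq> 0"
    using p by (auto simp: axis_eq_axis)
qed

lemma corona_vec_uminus: "corona_vec a (- x) = - corona_vec a x"
  by (simp add: vec_eq_iff_corona)

lemma pair_transfer_corona:
  fixes R :: "real^'c::finite \<Rightarrow> real^'c \<Rightarrow> bool" and a :: "'n::finite"
    and R' :: "real^('n + 'n \<times> 'c) \<Rightarrow> real^('n + 'n \<times> 'c) \<Rightarrow> bool"
  assumes "\<And>p q. p \<in> pair_states UNIV \<Longrightarrow> R' (corona_vec a p) (corona_vec a q) \<longleftrightarrow> R p q"
    and "\<And>p q v. p \<in> pair_states UNIV \<Longrightarrow> R' (corona_vec a p) q \<Longrightarrow> v \<notin> corona_copy a \<Longrightarrow> q $ v = 0"
  shows "(\<exists>p\<in>pair_states UNIV. \<exists>q\<in>pair_states UNIV. q \<noteq> p \<and> q \<noteq> - p \<and> R p q) \<longleftrightarrow>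
    (\<exists>p\<in>pair_states (corona_copy a). \<exists>q\<in>pair_states UNIV. q \<noteq> p \<and> q \<noteq> - p \<and> R' p q)"
    (is "?L \<longleftrightarrow> ?R")
proof -
  have distinct: "corona_vec a q \<noteq> corona_vec a p \<and> corona_vec a q \<noteq> - corona_vec a p \<longleftrightarrow>
      q \<noteq> p \<and> q \<noteq> - p" for p q :: "real^'c"
    by (simp flip: corona_vec_uminus)
  have "q \<in> corona_vec a ` pair_states UNIV"
    if "p \<in> pair_states UNIV" "q \<in> pair_states UNIV" "R' (corona_vec a p) q" for p q
    using pair_states_supported[OF that(2), of "corona_copy a"] assms(2)[OF that(1,3)]
    by (simp add: pair_states_corona_copy)
  moreover have "corona_vec a q \<in> pair_states UNIV" if "q \<in> pair_states UNIV" for q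
    using that pair_states_corona_copy pair_states_mono[OF subset_UNIV] by blast
  ultimately have "?R \<longleftrightarrow> (\<exists>p\<in>pair_states UNIV. \<exists>q\<in>pair_states UNIV.
      corona_vec a q \<noteq> corona_vec a p \<and> corona_vec a q \<noteq> - corona_vec a p \<and>
      R' (corona_vec a p) (corona_vec a q))"
    unfolding pair_states_corona_copy by blast
  also have "\<dots> \<longleftrightarrow> ?L"
    using distinct assms(1) by blast
  finally show ?thesis
    by simp
qed


theorem theorem19:
  fixes G :: "'n::finite \<Rightarrow> 'n \<Rightarrow> bool"
    and H :: "'c::finite \<Rightarrow> 'c \<Rightarrow> bool"
    and a :: 'n
    and M :: matrix_kind
  assumes "connected_graph G"
    and "simple_graph H"
    and "is_eigenvector (graph_matrix M H) 1"
  shows "(\<forall>x. x \<noteq> 0 \<and> 1 \<bullet> x = 0 \<longrightarrow>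
            (periodic M H x \<longleftrightarrow> periodic M (corona G H) (corona_vec a x)) \<and>
            (sedentary M H x \<longleftrightarrow> sedentary M (corona G H) (corona_vec a x)) \<and>
            (\<forall>y. y \<noteq> 0 \<longrightarrow>
               (PST M H x y \<longleftrightarrow> PST M (corona G H) (corona_vec a x) (corona_vec a y)) \<and>
               (PGST M H x y \<longleftrightarrow> PGST M (corona G H) (corona_vec a x) (corona_vec a y)))) \<and>
         (pair_PST M H \<longleftrightarrow> pair_PST_from (corona_copy a) M (corona G H)) \<and>
         (pair_PGST M H \<longleftrightarrow> pair_PGST_from (corona_copy a) M (corona G H)) \<and>
         (pair_PST M H \<longrightarrow> pair_PST M (corona G H)) \<and>
         (pair_PGST M H \<longrightarrow> pair_PGST M (corona G H))"
proof -
  note H = assms(2,3)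
  have PST: "pair_PST M H \<longleftrightarrow> pair_PST_from (corona_copy a) M (corona G H)"
    unfolding pair_PST_from_def
    by (intro pair_transfer_corona PST_corona_iff[OF H pair_state_sum_zero_nonzero(1)]
        PGST_corona_support[OF H pair_state_sum_zero_nonzero PST_imp_PGST])
  have PGST: "pair_PGST M H \<longleftrightarrow> pair_PGST_from (corona_copy a) M (corona G H)"
    unfolding pair_PGST_from_def
    by (intro pair_transfer_corona PGST_corona_iff[OF H pair_state_sum_zero_nonzero(1)]
        PGST_corona_support[OF H pair_state_sum_zero_nonzero])
  have "pair_PST_from (corona_copy a) M (corona G H) \<Longrightarrow> pair_PST M (corona G H)"
    "pair_PGST_from (corona_copy a) M (corona G H) \<Longrightarrow> pair_PGST M (corona G H)"
    unfolding pair_PST_from_def pair_PGST_from_def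
    using pair_states_mono[OF subset_UNIV] by blast+
  with PST PGST show ?thesis
    by (simp add: periodic_def PST_corona_iff[OF H] PGST_corona_iff[OF H] sedentary_corona_iff[OF H])
qed

end
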